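(* Let $\mathsf{v2l}$ be the Cedille term of type $\forall A{:}\star.\ \forall n{:}\mathsf{Nat}.\ \mathsf{Vec}\cdot A\ n\to\mathsf{List}\cdot A$, coercing inductive vectors to inductive lists, defined in the context. Then its erasure $|\mathsf{v2l}|$ is the identity function: $|\mathsf{v2l}| =_{\alpha\beta\eta} \lambda x.\,x$.
   Context: **Terms and erasure.** Terms are those of Cedille (type theory $\iota\lambda P2$), a type-annotated Curry-style dependent type theory. $\star$ is the kind of types; $\lambda x.\,t$ and $t\ t'$ are explicit abstraction and application (types $\Pi x{:}T.\,T'$, or $T\to T'$); $\Lambda x.\,t$ is implicit (erased) abstraction over a value or a type (types $\forall x{:}T.\,T'$, or $T\Rightarrow T'$ if non-dependent), with implicit value application $t\ {-}t'$ and type application $t\cdot T$; $[t,t']$, $t.1$, $t.2$ are the introduction and projections of the dependent intersection type $\iota x{:}T.\,T'$; $\beta$ and $\beta\{t\}$ are reflexivity proofs of the heterogeneous equality type $t_1\simeq t_2$; $\rho\ q - t$ is $t$ with its type rewritten by the equality proof $q$; $\varsigma\ q$ is symmetry of $q$. Erasure $|\cdot|$ maps annotated terms to untyped $\lambda$-terms: $|x|=x$, $|\lambda x.t|=\lambda x.|t|$, $|t\ t'|=|t|\ |t'|$, $|\Lambda x.t|=|t|$, $|t\ {-}t'|=|t|$, $|t\cdot T|=|t|$, $|[t,t']|=|t|$, $|t.1|=|t.2|=|t|$, $|\beta\{t\}|=|t|$, $|\beta|=\lambda x.x$, $|\rho\ q - t|=|t|$. Defined constants are unfolded. Erased terms are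 compared up to $\alpha\beta\eta$-equality. Type information does not affect erasure. **Lists.** $\mathsf{ListC}\cdot A=\forall X{:}\star.\ X\to(A\to X\to X)\to X$; $\mathsf{nilCL}=\Lambda A,X.\lambda c_N,c_C.\,c_N$; $\mathsf{consCL}=\Lambda A.\lambda x,xs.\Lambda X.\lambda c_N,c_C.\ c_C\ x\ (xs\cdot X\ c_N\ c_C)$; $\mathsf{ListP}\cdot A\ xsC=\forall X{:}\star.\forall P{:}X\to\star.\forall c_N{:}X.\forall c_C{:}A\to X\to X.\ P\ c_N\to(\forall xs{:}X.\Pi x{:}A.\ P\ xs\to P(c_C\ x\ xs))\to P(xsC\cdot X\ c_N\ c_C)$; $\mathsf{ListR}\cdot A\ xsC=(xsC\cdot(\mathsf{ListC}\cdot A)\ \mathsf{nilCL}\ \mathsf{consCL}\simeq xsC)$; $\mathsf{List}\cdot A=\iota xs{:}(\iota xsC{:}\mathsf{ListC}\cdot A.\ \mathsf{ListP}\cdot A\ xsC).\ \mathsf{ListR}\cdot A\ xs.1$. Helper: $\mathsf{mkList}:\forall A{:}\star.\Pi xs{:}(\iota xsC{:}\mathsf{ListC}\cdot A.\mathsf{ListP}\cdot A\ xsC).\ \mathsf{ListR}\cdot A\ xs.1\Rightarrow\mathsf{List}\cdot A$ is $\Lambda A.\lambda xs.\Lambda q.\,[xs,\ \rho\ q-\beta\{xs\}]$. **Vectors.** $\mathsf{Nat}$ is the type of naturals with $\mathsf{zero},\mathsf{suc}$. $\mathsf{VecC}\cdot A\ n=\forall X{:}\mathsf{Nat}\to\star.\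 X\ \mathsf{zero}\to(\forall n{:}\mathsf{Nat}.\ A\to X\ n\to X(\mathsf{suc}\ n))\to X\ n$; $\mathsf{nilCV}=\Lambda A,X.\lambda c_N,c_C.\,c_N$; $\mathsf{consCV}=\Lambda A,n.\lambda x,xs.\Lambda X.\lambda c_N,c_C.\ c_C\ {-}n\ x\ (xs\cdot X\ c_N\ c_C)$; $\mathsf{VecP}\cdot A\ n\ xsC=\forall X{:}\mathsf{Nat}\to\star.\forall P{:}\Pi n{:}\mathsf{Nat}.X\ n\to\star.\forall c_N{:}X\ \mathsf{zero}.\forall c_C{:}(\forall n{:}\mathsf{Nat}.A\to X\ n\to X(\mathsf{suc}\ n)).\ P\ \mathsf{zero}\ c_N\to(\forall n{:}\mathsf{Nat}.\forall xs{:}X\ n.\Pi x{:}A.\ P\ n\ xs\to P(\mathsf{suc}\ n)(c_C\ {-}n\ x\ xs))\to P\ n\ (xsC\cdot X\ c_N\ c_C)$; $\mathsf{VecR}\cdot A\ n\ xsC=(xsC\cdot(\mathsf{VecC}\cdot A)\ \mathsf{nilCV}\ \mathsf{consCV}\simeq xsC)$; $\mathsf{Vec}\cdot A\ n=\iota xs{:}(\iota xsC{:}\mathsf{VecC}\cdot A\ n.\ \mathsf{VecP}\cdot A\ n\ xsC).\ \mathsf{VecR}\cdot A\ n\ xs.1$. **The coercion.** $\mathsf{v2lC}:\forall A.\forall n.\ \mathsf{Vec}\cdot A\ n\to\mathsf{ListC}\cdot A$ is $\Lambda A.\Lambda n.\lambda xs.\Lambda X.\lambda c_N.\lambda c_C.\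 xs.1.1\cdot(\lambda\_{:}\mathsf{Nat}.X)\ c_N\ (\Lambda\_.\,c_C)$. $\mathsf{v2lP}:\forall A.\forall n.\Pi xs{:}\mathsf{Vec}\cdot A\ n.\ \mathsf{ListP}\cdot A\ (\mathsf{v2lC}\cdot A\ {-}n\ xs)$ is $\Lambda A.\Lambda n.\lambda xs.\Lambda X.\Lambda P.\Lambda c_N.\Lambda c_C.\lambda p_N.\lambda p_C.\ xs.1.2\cdot(\lambda\_{:}\mathsf{Nat}.X)\cdot(\lambda\_{:}\mathsf{Nat}.P)\ {-}c_N\ {-}(\Lambda\_.\,c_C)\ p_N\ (\Lambda\_.\,p_C)$. $\mathsf{v2lR}:\forall A.\forall n.\Pi xs{:}\mathsf{Vec}\cdot A\ n.\ \mathsf{ListR}\cdot A\ (\mathsf{v2lC}\cdot A\ {-}n\ xs)$ is $\Lambda A.\Lambda n.\lambda xs.\ xs.2$. $\mathsf{v2l}=\Lambda A.\Lambda n.\lambda xs.\ \mathsf{mkList}\cdot A\ [\mathsf{v2lC}\cdot A\ {-}n\ xs,\ \mathsf{v2lP}\cdot A\ {-}n\ xs]\ {-}(\mathsf{v2lR}\cdot A\ {-}n\ xs)$. *)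

theory Defs
  imports Main
begin

type_synonym name = string


section \<open>Untyped lambda terms up to alpha-beta-eta\<close>

datatype lterm =
    LVar name
  | LLam name lterm
  | LApp lterm lterm

primrec fv :: "lterm \<Rightarrow> name set" where
  "fv (LVar x) = {x}"
| "fv (LLam x t) = fv t - {x}"
| "fv (LApp t u) = fv t \<union> fv u"

definition fresh :: "name \<Rightarrow> name set \<Rightarrow> name" where
  "fresh x S = (if x \<notin> S then x else (SOME y. y \<notin> S))"

text \<open>Simultaneous capture-avoiding substitution. Under a binder the bound variable is renamed
  whenever it is free in the image of some other free variable of the body; \<open>S\<close> is finite and
  \<^typ>\<open>name\<close> is infinite, so that a fresh name exists.\<close>

primrec psubst :: "(name \<Rightarrow> lterm) \<Rightarrow> lterm \<Rightarrow> lterm" where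
  "psubst \<sigma> (LVar x) = \<sigma> x"
| "psubst \<sigma> (LLam x t) =
     (let S = (\<Union>z \<in> fv t - {x}. fv (\<sigma> z)); y = fresh x S
      in LLam y (psubst (\<sigma>(x := LVar y)) t))"
| "psubst \<sigma> (LApp t u) = LApp (psubst \<sigma> t) (psubst \<sigma> u)"

definition subst :: "lterm \<Rightarrow> name \<Rightarrow> lterm \<Rightarrow> lterm" where
  "subst t x s = psubst (LVar(x := s)) t"

inductive abe_eq :: "lterm \<Rightarrow> lterm \<Rightarrow> bool"  (infix "=\<^sub>\<alpha>\<^sub>\<beta>\<^sub>\<eta>" 50) where
  alpha: "y \<notin> fv t \<Longrightarrow> LLam x t =\<^sub>\<alpha>\<^sub>\<beta>\<^sub>\<eta> LLam y (subst t x (LVar y))"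
| beta:  "LApp (LLam x t) s =\<^sub>\<alpha>\<^sub>\<beta>\<^sub>\<eta> subst t x s"
| eta:   "x \<notin> fv t \<Longrightarrow> LLam x (LApp t (LVar x)) =\<^sub>\<alpha>\<^sub>\<beta>\<^sub>\<eta> t"
| refl:  "t =\<^sub>\<alpha>\<^sub>\<beta>\<^sub>\<eta> t"
| sym:   "t =\<^sub>\<alpha>\<^sub>\<beta>\<^sub>\<eta> u \<Longrightarrow> u =\<^sub>\<alpha>\<^sub>\<beta>\<^sub>\<eta> t"
| trans: "t =\<^sub>\<alpha>\<^sub>\<beta>\<^sub>\<eta> u \<Longrightarrow> u =\<^sub>\<alpha>\<^sub>\<beta>\<^sub>\<eta> v \<Longrightarrow> t =\<^sub>\<alpha>\<^sub>\<beta>\<^sub>\<eta> v"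
| lam:   "t =\<^sub>\<alpha>\<^sub>\<beta>\<^sub>\<eta> u \<Longrightarrow> LLam x t =\<^sub>\<alpha>\<^sub>\<beta>\<^sub>\<eta> LLam x u"
| app:   "t =\<^sub>\<alpha>\<^sub>\<beta>\<^sub>\<eta> t' \<Longrightarrow> u =\<^sub>\<alpha>\<^sub>\<beta>\<^sub>\<eta> u' \<Longrightarrow> LApp t u =\<^sub>\<alpha>\<^sub>\<beta>\<^sub>\<eta> LApp t' u'"


section \<open>Annotated Cedille syntax and erasure\<close>

text \<open>
  Kinds, types and terms are raw (not necessarily well-typed) syntax with named variables.

  \<^item> \<open>KPi\<close> and \<open>KPiK\<close> are the kinds \<open>\<Pi> x:T. K\<close> and \<open>\<Pi> X:K. K'\<close>.
  \<^item> \<open>AllK\<close> is \<open>\<forall> X:K. T\<close>; \<open>All\<close>, \<open>Pi\<close>, \<open>Iota\<close> are \<open>\<forall> x:T. T'\<close>, \<open>\<Pi> x:T. T'\<close>, \<open>\<iota> x:T. T'\<close>.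
  \<^item> \<open>TLam\<close> and \<open>TLamK\<close> are the type-level abstractions \<open>\<lambda> x:T. T'\<close> and \<open>\<lambda> X:K. T\<close>;
    \<open>T \<oplus> t\<close> and \<open>T \<otimes> T'\<close> apply a type to a term and to a type.
  \<^item> \<open>ILam\<close> is the implicit abstraction \<open>\<Lambda> x. t\<close>, over a value or over a type.
  \<^item> \<open>t \<bullet> t'\<close>, \<open>t \<ominus> t'\<close>, \<open>t \<odot> T\<close> are explicit application, implicit value application \<open>t -t'\<close>
    and type application.
  \<^item> \<open>Beta\<close>, \<open>BetaOf t\<close>, \<open>Rho q t\<close>, \<open>Sym q\<close> are \<open>\<beta>\<close>, \<open>\<beta>{t}\<close>, \<open>\<rho> q - t\<close>, and the
    symmetry of \<open>q\<close>, which erases to \<open>q\<close> as in Cedille.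
  \<^item> \<open>Const T t\<close> is an occurrence of a constant with declared type \<open>T\<close> and definiens \<open>t\<close>. Both are
    closed (up to the parameters for the naturals below), so no binder at a place of use captures
    a variable of the definiens.
\<close>

datatype kind =
    Star
  | KPi name ty kind
  | KPiK name kind kind
and ty =
    TVar name
  | AllK name kind ty
  | All name ty ty
  | Pi name ty ty
  | Iota name ty ty
  | Eq trm trm  (infix "\<simeq>" 60)
  | TLam name ty ty
  | TLamK name kind ty
  | TApp ty trm  (infixl "\<oplus>" 100)
  | TAppT ty ty  (infixl "\<otimes>" 100)
and trm =
    Var name
  | Lam name trm
  | App trm trm  (infixl "\<bullet>" 100)
  | ILam name trm
  | IApp trm trm  (infixl "\<ominus>" 100)
  | TyApp trm ty  (infixl "\<odot>" 100)
  | IPair trm trm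
  | Proj1 trm
  | Proj2 trm
  | Beta
  | BetaOf trm
  | Rho trm trm
  | Sym trm
  | Const ty trm

abbreviation Arr :: "ty \<Rightarrow> ty \<Rightarrow> ty"  (infixr "\<rightarrow>" 55) where
  "T \<rightarrow> T' \<equiv> Pi ''_'' T T'"

abbreviation IArr :: "ty \<Rightarrow> ty \<Rightarrow> ty"  (infixr "\<Rrightarrow>" 55) where
  "T \<Rrightarrow> T' \<equiv> All ''_'' T T'"

primrec erase :: "trm \<Rightarrow> lterm" where
  "erase (Var x) = LVar x"
| "erase (Lam x t) = LLam x (erase t)"
| "erase (t \<bullet> u) = LApp (erase t) (erase u)"
| "erase (ILam x t) = erase t"
| "erase (t \<ominus> u) = erase t"
| "erase (t \<odot> T) = erase t"
| "erase (IPair t u) = erase t"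
| "erase (Proj1 t) = erase t"
| "erase (Proj2 t) = erase t"
| "erase Beta = LLam ''x'' (LVar ''x'')"
| "erase (BetaOf t) = erase t"
| "erase (Rho q t) = erase t"
| "erase (Sym q) = erase q"
| "erase (Const T t) = erase t"


section \<open>Lists\<close>

definition ListC :: ty where
  "ListC = TLamK ''A'' Star
     (AllK ''X'' Star
       (TVar ''X'' \<rightarrow> (TVar ''A'' \<rightarrow> TVar ''X'' \<rightarrow> TVar ''X'') \<rightarrow> TVar ''X''))"

definition nilCL :: trm where
  "nilCL = ILam ''A'' (ILam ''X'' (Lam ''cN'' (Lam ''cC'' (Var ''cN''))))"

definition consCL :: trm where
  "consCL = ILam ''A'' (Lam ''x'' (Lam ''xs'' (ILam ''X'' (Lam ''cN'' (Lam ''cC''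
     (Var ''cC'' \<bullet> Var ''x'' \<bullet>
       (Var ''xs'' \<odot> TVar ''X'' \<bullet> Var ''cN'' \<bullet> Var ''cC'')))))))"

definition ListP :: ty where
  "ListP = TLamK ''A'' Star (TLam ''xsC'' (ListC \<otimes> TVar ''A'')
     (AllK ''X'' Star (AllK ''P'' (KPi ''_'' (TVar ''X'') Star)
       (All ''cN'' (TVar ''X'') (All ''cC'' (TVar ''A'' \<rightarrow> TVar ''X'' \<rightarrow> TVar ''X'')
         (TVar ''P'' \<oplus> Var ''cN''
          \<rightarrow> All ''xs'' (TVar ''X'') (Pi ''x'' (TVar ''A'')
               (TVar ''P'' \<oplus> Var ''xs'' \<rightarrow> TVar ''P'' \<oplus> (Var ''cC'' \<bullet> Var ''x'' \<bullet> Var ''xs'')))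
          \<rightarrow> TVar ''P'' \<oplus> (Var ''xsC'' \<odot> TVar ''X'' \<bullet> Var ''cN'' \<bullet> Var ''cC'')))))))"

definition ListR :: ty where
  "ListR = TLamK ''A'' Star (TLam ''xsC'' (ListC \<otimes> TVar ''A'')
     (Var ''xsC'' \<odot> (ListC \<otimes> TVar ''A'') \<bullet> nilCL \<bullet> consCL \<simeq> Var ''xsC''))"

definition List :: ty where
  "List = TLamK ''A'' Star
     (Iota ''xs'' (Iota ''xsC'' (ListC \<otimes> TVar ''A'') (ListP \<otimes> TVar ''A'' \<oplus> Var ''xsC''))
       (ListR \<otimes> TVar ''A'' \<oplus> Proj1 (Var ''xs'')))"

definition mkList :: trm where
  "mkList = Const
     (AllK ''A'' Star
       (Pi ''xs'' (Iota ''xsC'' (ListC \<otimes> TVar ''A'') (ListP \<otimes> TVar ''A'' \<oplus> Var ''xsC''))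
         (ListR \<otimes> TVar ''A'' \<oplus> Proj1 (Var ''xs'') \<Rrightarrow> List \<otimes> TVar ''A'')))
     (ILam ''A'' (Lam ''xs'' (ILam ''q''
       (IPair (Var ''xs'') (Rho (Var ''q'') (BetaOf (Var ''xs'')))))))"


section \<open>Vectors and the coercion\<close>

definition nilCV :: trm where
  "nilCV = ILam ''A'' (ILam ''X'' (Lam ''cN'' (Lam ''cC'' (Var ''cN''))))"

definition consCV :: trm where
  "consCV = ILam ''A'' (ILam ''n'' (Lam ''x'' (Lam ''xs'' (ILam ''X'' (Lam ''cN'' (Lam ''cC''
     (Var ''cC'' \<ominus> Var ''n'' \<bullet> Var ''x'' \<bullet>
       (Var ''xs'' \<odot> TVar ''X'' \<bullet> Var ''cN'' \<bullet> Var ''cC''))))))))"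

text \<open>The naturals enter only through annotations, and their type and constructors are parameters.
  Outside this context the definitions take them as leading arguments, as in \<open>v2l Nat zero suc\<close>.\<close>

context
  fixes Nat :: ty and zero suc :: trm
begin

definition VecC :: ty where
  "VecC = TLamK ''A'' Star (TLam ''n'' Nat
     (AllK ''X'' (KPi ''_'' Nat Star)
       (TVar ''X'' \<oplus> zero
        \<rightarrow> All ''n'' Nat
             (TVar ''A'' \<rightarrow> TVar ''X'' \<oplus> Var ''n'' \<rightarrow> TVar ''X'' \<oplus> (suc \<bullet> Var ''n''))
        \<rightarrow> TVar ''X'' \<oplus> Var ''n'')))"

definition VecP :: ty where
  "VecP = TLamK ''A'' Star (TLam ''n'' Nat (TLam ''xsC'' (VecC \<otimes> TVar ''A'' \<oplus> Var ''n'')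
     (AllK ''X'' (KPi ''_'' Nat Star)
       (AllK ''P'' (KPi ''n'' Nat (KPi ''_'' (TVar ''X'' \<oplus> Var ''n'') Star))
         (All ''cN'' (TVar ''X'' \<oplus> zero)
           (All ''cC''
             (All ''n'' Nat
               (TVar ''A'' \<rightarrow> TVar ''X'' \<oplus> Var ''n'' \<rightarrow> TVar ''X'' \<oplus> (suc \<bullet> Var ''n'')))
             (TVar ''P'' \<oplus> zero \<oplus> Var ''cN''
              \<rightarrow> All ''n'' Nat (All ''xs'' (TVar ''X'' \<oplus> Var ''n'') (Pi ''x'' (TVar ''A'')
                   (TVar ''P'' \<oplus> Var ''n'' \<oplus> Var ''xs''
                    \<rightarrow> TVar ''P'' \<oplus> (suc \<bullet> Var ''n'')
                         \<oplus> (Var ''cC'' \<ominus> Var ''n'' \<bullet> Var ''x'' \<bullet> Var ''xs''))))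
              \<rightarrow> TVar ''P'' \<oplus> Var ''n''
                   \<oplus> (Var ''xsC'' \<odot> TVar ''X'' \<bullet> Var ''cN'' \<bullet> Var ''cC''))))))))"

definition VecR :: ty where
  "VecR = TLamK ''A'' Star (TLam ''n'' Nat (TLam ''xsC'' (VecC \<otimes> TVar ''A'' \<oplus> Var ''n'')
     (Var ''xsC'' \<odot> (VecC \<otimes> TVar ''A'') \<bullet> nilCV \<bullet> consCV \<simeq> Var ''xsC'')))"

definition Vec :: ty where
  "Vec = TLamK ''A'' Star (TLam ''n'' Nat
     (Iota ''xs''
       (Iota ''xsC'' (VecC \<otimes> TVar ''A'' \<oplus> Var ''n'')
         (VecP \<otimes> TVar ''A'' \<oplus> Var ''n'' \<oplus> Var ''xsC''))
       (VecR \<otimes> TVar ''A'' \<oplus> Var ''n'' \<oplus> Proj1 (Var ''xs''))))"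

definition v2lC :: trm where
  "v2lC = Const
     (AllK ''A'' Star (All ''n'' Nat (Vec \<otimes> TVar ''A'' \<oplus> Var ''n'' \<rightarrow> ListC \<otimes> TVar ''A'')))
     (ILam ''A'' (ILam ''n'' (Lam ''xs'' (ILam ''X'' (Lam ''cN'' (Lam ''cC''
       (Proj1 (Proj1 (Var ''xs'')) \<odot> TLam ''_'' Nat (TVar ''X'')
          \<bullet> Var ''cN'' \<bullet> ILam ''_'' (Var ''cC''))))))))"

definition v2lP :: trm where
  "v2lP = Const
     (AllK ''A'' Star (All ''n'' Nat (Pi ''xs'' (Vec \<otimes> TVar ''A'' \<oplus> Var ''n'')
       (ListP \<otimes> TVar ''A'' \<oplus> (v2lC \<odot> TVar ''A'' \<ominus> Var ''n'' \<bullet> Var ''xs'')))))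
     (ILam ''A'' (ILam ''n'' (Lam ''xs'' (ILam ''X'' (ILam ''P'' (ILam ''cN'' (ILam ''cC''
       (Lam ''pN'' (Lam ''pC''
         (Proj2 (Proj1 (Var ''xs''))
            \<odot> TLam ''_'' Nat (TVar ''X'') \<odot> TLam ''_'' Nat (TVar ''P'')
            \<ominus> Var ''cN'' \<ominus> ILam ''_'' (Var ''cC'')
            \<bullet> Var ''pN'' \<bullet> ILam ''_'' (Var ''pC'')))))))))))"

definition v2lR :: trm where
  "v2lR = Const
     (AllK ''A'' Star (All ''n'' Nat (Pi ''xs'' (Vec \<otimes> TVar ''A'' \<oplus> Var ''n'')
       (ListR \<otimes> TVar ''A'' \<oplus> (v2lC \<odot> TVar ''A'' \<ominus> Var ''n'' \<bullet> Var ''xs'')))))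
     (ILam ''A'' (ILam ''n'' (Lam ''xs'' (Proj2 (Var ''xs'')))))"

definition v2l :: trm where
  "v2l = Const
     (AllK ''A'' Star (All ''n'' Nat (Vec \<otimes> TVar ''A'' \<oplus> Var ''n'' \<rightarrow> List \<otimes> TVar ''A'')))
     (ILam ''A'' (ILam ''n'' (Lam ''xs''
       (mkList \<odot> TVar ''A''
          \<bullet> IPair (v2lC \<odot> TVar ''A'' \<ominus> Var ''n'' \<bullet> Var ''xs'')
                  (v2lP \<odot> TVar ''A'' \<ominus> Var ''n'' \<bullet> Var ''xs'')
          \<ominus> (v2lR \<odot> TVar ''A'' \<ominus> Var ''n'' \<bullet> Var ''xs'')))))"

end

end

theory Submission
  imports Defs
begin

text \<open>The erasure is \<open>\<lambda>xs. (\<lambda>xs. xs) ((\<lambda>xs cN cC. xs cN cC) xs)\<close>: \<open>mkList\<close> erases to the identity,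
  and \<open>v2lC\<close> to a twofold \<open>\<eta>\<close>-expansion of it, since the dummy index abstraction around \<open>cC\<close>
  leaves no trace.\<close>

declare abe_eq.trans [trans]

text \<open>Under a binder, \<open>x\<close> is not in \<open>fv t - {x}\<close>, so
  \<open>fresh\<close> keeps \<open>x\<close>, and the updated map \<open>LVar(x := LVar x)\<close>
  is again \<open>LVar\<close>.\<close>

lemma psubst_LVar [simp]: "psubst LVar t = t"
  by (induction t) (auto simp: Let_def fresh_def)

lemma subst_LVar_self [simp]: "subst t x (LVar x) = t"
  by (simp add: subst_def)

lemma eta2:
  assumes "x \<notin> fv t" "y \<notin> fv t" "x \<noteq> y"
  shows "LLam x (LLam y (LApp (LApp t (LVar x)) (LVar y))) =\<^sub>\<alpha>\<^sub>\<beta>\<^sub>\<eta> t"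
proof -
  have "LLam x (LLam y (LApp (LApp t (LVar x)) (LVar y))) =\<^sub>\<alpha>\<^sub>\<beta>\<^sub>\<eta> LLam x (LApp t (LVar x))"
    using assms by (intro abe_eq.lam abe_eq.eta) auto
  also note abe_eq.eta[OF assms(1)]
  finally show ?thesis .
qed

lemma id_app: "LApp (LLam x (LVar x)) t =\<^sub>\<alpha>\<^sub>\<beta>\<^sub>\<eta> t"
  using abe_eq.beta[of x "LVar x" t] by (simp add: subst_def)

lemma alpha_id: "LLam x (LVar x) =\<^sub>\<alpha>\<^sub>\<beta>\<^sub>\<eta> LLam y (LVar y)"
\<comment> \<open>\<open>alpha\<close> requires a new name not free in the body
  \<open>LVar x\<close>, so equal names fall to reflexivity.\<close>
proof (cases "y = x")
  case False
  then show ?thesis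
    using abe_eq.alpha[of y "LVar x" x] by (simp add: subst_def)
qed (simp add: abe_eq.refl)

lemma erase_mkList: "erase mkList = LLam ''xs'' (LVar ''xs'')"
  by (simp add: mkList_def)

lemma erase_v2lC:
  "erase (v2lC N z s) =
     LLam ''xs'' (LLam ''cN'' (LLam ''cC'' (LApp (LApp (LVar ''xs'') (LVar ''cN'')) (LVar ''cC''))))"
  by (simp add: v2lC_def)

text \<open>Erasing a pair keeps its first component and erasing \<ominus> drops the argument, which
  removes \<open>v2lP\<close> and \<open>v2lR\<close>.\<close>

lemma erase_v2l:
  "erase (v2l N z s) =
     LLam ''xs'' (LApp (erase mkList) (LApp (erase (v2lC N z s)) (LVar ''xs'')))"
  by (simp add: v2l_def)

theorem theorem3p3:
  fixes Nat :: ty and zero suc :: trm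
  shows "erase (v2l Nat zero suc) =\<^sub>\<alpha>\<^sub>\<beta>\<^sub>\<eta> LLam ''x'' (LVar ''x'')"
proof -
  let ?xs = "LVar ''xs''"
  let ?C = "LLam ''cN'' (LLam ''cC'' (LApp (LApp ?xs (LVar ''cN'')) (LVar ''cC'')))"
  have "LApp (erase mkList) (LApp (erase (v2lC Nat zero suc)) ?xs) =\<^sub>\<alpha>\<^sub>\<beta>\<^sub>\<eta> LApp (LLam ''xs'' ?C) ?xs"
    unfolding erase_mkList erase_v2lC by (rule id_app)
  \<comment> \<open>The argument is the bound variable itself, so contraction returns
    \<open>?C\<close> literally, with no binder renamed.\<close>
  also have "LApp (LLam ''xs'' ?C) ?xs =\<^sub>\<alpha>\<^sub>\<beta>\<^sub>\<eta> ?C"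
    using abe_eq.beta[of "''xs''" ?C ?xs] by (simp only: subst_LVar_self)
  also have "?C =\<^sub>\<alpha>\<^sub>\<beta>\<^sub>\<eta> ?xs"
    by (rule eta2) auto
  \<comment> \<open>The chain so far relates bodies with \<open>xs\<close> free; congruence restores
    the outer binder.\<close>
  finally have "erase (v2l Nat zero suc) =\<^sub>\<alpha>\<^sub>\<beta>\<^sub>\<eta> LLam ''xs'' ?xs"
    unfolding erase_v2l by (rule abe_eq.lam)
  also have "LLam ''xs'' ?xs =\<^sub>\<alpha>\<^sub>\<beta>\<^sub>\<eta> LLam ''x'' (LVar ''x'')"
    by (rule alpha_id)
  finally show ?thesis .
qed

end
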